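(* For every $\Phi\in C^\infty(\mathbb R^{n+m})$ and every smooth positive probability density $\rho$, $$\mathrm{Hess}_{W_a}\mathrm D(\rho)(V_\Phi,V_\Phi)=\int\Gamma_2(\Phi,\Phi)\,\rho(x)\,dx,$$ where $\mathrm D(\rho)=\int\rho\log\frac\rho\pi\,dx$.
   Context: $n,m\ge1$, $a:\mathbb R^{n+m}\to\mathbb R^{(n+m)\times n}$ is a smooth matrix function whose columns satisfy the strong H\"ormander condition, $\pi$ a smooth positive probability density. $Lf=\nabla\cdot(aa^{\mathsf T}\nabla f)+(\nabla\log\pi,aa^{\mathsf T}\nabla f)$, $\Gamma_1(f,g)=\langle a^{\mathsf T}\nabla f,a^{\mathsf T}\nabla g\rangle$, $\Gamma_2(f,f)=\frac12L\Gamma_1(f,f)-\Gamma_1(Lf,f)$. For a smooth function $\Phi$, $V_\Phi=-\nabla\cdot(\rho aa^{\mathsf T}\nabla\Phi)$ is the corresponding tangent vector at $\rho$ in the space of densities. For a functional $\mathcal F$ of densities, its Hessian in the sub-Riemannian density manifold is $\mathrm{Hess}_{W_a}\mathcal F(\rho)(V_\Phi,V_\Phi)=\frac{d^2}{dt^2}\mathcal F(\rho_t)|_{t=0}$, where $(\rho_t,\Phi_t)$ solves the geodesic equations $\partial_t\rho_t+\nabla\cdot(\rho_taa^{\mathsf T}\nabla\Phi_t)=0$, $\partial_t\Phi_t+\frac12(a^{\mathsf T}\nabla\Phi_t,a^{\mathsf T}\nabla\Phi_t)=0$ with $\rho_0=\rho$, $\Phi_0=\Phi$. All functions are such that the integrals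 and integrations by parts on $\mathbb R^{n+m}$ make sense without boundary terms (the paper works formally in this respect). *)

theory Defs
  imports "HOL-Analysis.Analysis"
begin

text \<open>C-infinity on an open set: all iterated directional derivatives exist and are
  continuous.\<close>

fun times_continuously_differentiable_on ::
    "nat \<Rightarrow> 'a::real_normed_vector set \<Rightarrow> ('a \<Rightarrow> 'b::real_normed_vector) \<Rightarrow> bool" where
  "times_continuously_differentiable_on 0 S f \<longleftrightarrow> continuous_on S f"
| "times_continuously_differentiable_on (Suc k) S f \<longleftrightarrow>
     (\<forall>x\<in>S. f differentiable (at x)) \<and>
     (\<forall>v. times_continuously_differentiable_on k S (\<lambda>x. frechet_derivative f (at x) v))"

definition smooth_on ::
    "'a::real_normed_vector set \<Rightarrow> ('a \<Rightarrow> 'b::real_normed_vector) \<Rightarrow> bool" where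
  "smooth_on S f \<longleftrightarrow> (\<forall>k. times_continuously_differentiable_on k S f)"

definition gradient :: "(real^'k \<Rightarrow> real) \<Rightarrow> real^'k \<Rightarrow> real^'k" where
  "gradient f x = (\<chi> i. frechet_derivative f (at x) (axis i 1))"

definition divergence :: "(real^'k \<Rightarrow> real^'k) \<Rightarrow> real^'k \<Rightarrow> real" where
  "divergence X x = (\<Sum>i\<in>UNIV. frechet_derivative (\<lambda>y. X y $ i) (at x) (axis i 1))"

definition lie_bracket ::
    "(real^'k \<Rightarrow> real^'k) \<Rightarrow> (real^'k \<Rightarrow> real^'k) \<Rightarrow> real^'k \<Rightarrow> real^'k" where
  "lie_bracket X Y x = frechet_derivative Y (at x) (X x) - frechet_derivative X (at x) (Y x)"

text \<open>The linear span of the iterated brackets below is the real Lie algebra generated by the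
  columns of \<open>a\<close>.  The condition is the strong (driftless) one: only the columns
  themselves, and no first-order drift field, serve as generators.\<close>

inductive_set iterated_brackets :: "(real^'k \<Rightarrow> real^'n^'k) \<Rightarrow> (real^'k \<Rightarrow> real^'k) set"
  for a :: "real^'k \<Rightarrow> real^'n^'k" where
  column: "(\<lambda>x. column j (a x)) \<in> iterated_brackets a"
| bracket: "X \<in> iterated_brackets a \<Longrightarrow> Y \<in> iterated_brackets a \<Longrightarrow>
    lie_bracket X Y \<in> iterated_brackets a"

definition strong_hormander :: "(real^'k \<Rightarrow> real^'n^'k) \<Rightarrow> bool" where
  "strong_hormander a \<longleftrightarrow> (\<forall>x. span {X x | X. X \<in> iterated_brackets a} = UNIV)"

definition smooth_positive_density :: "(real^'k \<Rightarrow> real) \<Rightarrow> bool" where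
  "smooth_positive_density \<rho> \<longleftrightarrow>
     smooth_on UNIV \<rho> \<and> (\<forall>x. 0 < \<rho> x) \<and> has_bochner_integral lborel \<rho> 1"

definition horizontal_gradient ::
    "(real^'k \<Rightarrow> real^'n^'k) \<Rightarrow> (real^'k \<Rightarrow> real) \<Rightarrow> real^'k \<Rightarrow> real^'k" where
  "horizontal_gradient a f x = (a x ** transpose (a x)) *v gradient f x"

definition generator_L ::
    "(real^'k \<Rightarrow> real^'n^'k) \<Rightarrow> (real^'k \<Rightarrow> real) \<Rightarrow> (real^'k \<Rightarrow> real) \<Rightarrow> real^'k \<Rightarrow> real" where
  "generator_L a \<pi> f x =
     divergence (horizontal_gradient a f) x
     + gradient (\<lambda>y. ln (\<pi> y)) x \<bullet> horizontal_gradient a f x"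

definition Gamma1 ::
    "(real^'k \<Rightarrow> real^'n^'k) \<Rightarrow> (real^'k \<Rightarrow> real) \<Rightarrow> (real^'k \<Rightarrow> real) \<Rightarrow> real^'k \<Rightarrow> real" where
  "Gamma1 a f g x = (transpose (a x) *v gradient f x) \<bullet> (transpose (a x) *v gradient g x)"

text \<open>The diagonal value \<open>\<Gamma>\<^sub>2(f, f)\<close>.\<close>

definition Gamma2 ::
    "(real^'k \<Rightarrow> real^'n^'k) \<Rightarrow> (real^'k \<Rightarrow> real) \<Rightarrow> (real^'k \<Rightarrow> real) \<Rightarrow> real^'k \<Rightarrow> real" where
  "Gamma2 a \<pi> f x =
     1 / 2 * generator_L a \<pi> (Gamma1 a f f) x - Gamma1 a (generator_L a \<pi> f) f x"

definition relative_entropy :: "(real^'k \<Rightarrow> real) \<Rightarrow> (real^'k \<Rightarrow> real) \<Rightarrow> real" where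
  "relative_entropy \<pi> \<rho> = (LINT x|lborel. \<rho> x * ln (\<rho> x / \<pi> x))"

definition tangent_vector ::
    "(real^'k \<Rightarrow> real^'n^'k) \<Rightarrow> (real^'k \<Rightarrow> real) \<Rightarrow> (real^'k \<Rightarrow> real) \<Rightarrow> real^'k \<Rightarrow> real" where
  "tangent_vector a \<rho> \<Phi> x = - divergence (\<lambda>y. \<rho> y *\<^sub>R horizontal_gradient a \<Phi> y) x"

text \<open>A smooth solution \<open>(r, p)\<close> of the geodesic equations on the time interval
  \<open>(-T, T)\<close>, issued from \<open>(\<rho>, \<Phi>)\<close>.\<close>

definition geodesic_from ::
    "(real^'k \<Rightarrow> real^'n^'k) \<Rightarrow> (real^'k \<Rightarrow> real) \<Rightarrow> (real^'k \<Rightarrow> real) \<Rightarrow>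
     real \<Rightarrow> (real \<Rightarrow> real^'k \<Rightarrow> real) \<Rightarrow> (real \<Rightarrow> real^'k \<Rightarrow> real) \<Rightarrow> bool" where
  "geodesic_from a \<rho> \<Phi> T r p \<longleftrightarrow>
     0 < T \<and> r 0 = \<rho> \<and> p 0 = \<Phi> \<and>
     smooth_on ({-T<..<T} \<times> UNIV) (\<lambda>(t, x). r t x) \<and>
     smooth_on ({-T<..<T} \<times> UNIV) (\<lambda>(t, x). p t x) \<and>
     (\<forall>t\<in>{-T<..<T}. smooth_positive_density (r t)) \<and>
     (\<forall>t\<in>{-T<..<T}. \<forall>x.
        ((\<lambda>s. r s x) has_real_derivative tangent_vector a (r t) (p t) x) (at t) \<and>
        ((\<lambda>s. p s x) has_real_derivative - (1 / 2 * Gamma1 a (p t) (p t) x)) (at t))"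

definition has_second_derivative_at :: "(real \<Rightarrow> real) \<Rightarrow> real \<Rightarrow> real \<Rightarrow> bool" where
  "has_second_derivative_at f H t \<longleftrightarrow>
     (\<exists>f'. (\<forall>\<^sub>F s in nhds t. (f has_real_derivative f' s) (at s)) \<and>
           (f' has_real_derivative H) (at t))"

text \<open>\<open>H\<close> is the value at \<open>(V\<^sub>\<Phi>, V\<^sub>\<Phi>)\<close> of the
  Hessian of \<open>F\<close> at \<open>\<rho>\<close>.  The predicate \<open>C\<close> is the class of curves
  in which the geodesic equations are solved.  The value is required to be the same along all
  geodesics of the class, and at least one of them must exist, so that it is unique.\<close>

definition has_Hess_W ::
    "(real^'k \<Rightarrow> real^'n^'k) \<Rightarrow>
     (real \<Rightarrow> (real \<Rightarrow> real^'k \<Rightarrow> real) \<Rightarrow> (real \<Rightarrow> real^'k \<Rightarrow> real) \<Rightarrow> bool) \<Rightarrow>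
     ((real^'k \<Rightarrow> real) \<Rightarrow> real) \<Rightarrow> (real^'k \<Rightarrow> real) \<Rightarrow> (real^'k \<Rightarrow> real) \<Rightarrow> real \<Rightarrow> bool" where
  "has_Hess_W a C F \<rho> \<Phi> H \<longleftrightarrow>
     (\<exists>T r p. geodesic_from a \<rho> \<Phi> T r p \<and> C T r p) \<and>
     (\<forall>T r p. geodesic_from a \<rho> \<Phi> T r p \<and> C T r p \<longrightarrow>
        has_second_derivative_at (\<lambda>t. F (r t)) H 0)"

text \<open>The formal assumption that integrals and integrations by parts make sense is rendered by
  absolute integrability only.  A smooth field \<open>X\<close> that is integrable together with its
  divergence has no flux through infinity, so \<open>\<integral> divergence X = 0\<close> is a
  consequence (by cut-off) and not part of the definition.\<close>

definition integrable_field :: "(real^'k \<Rightarrow> real^'k) \<Rightarrow> bool" where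
  "integrable_field X \<longleftrightarrow> integrable lborel X \<and> integrable lborel (divergence X)"

definition differentiable_under_integral :: "real \<Rightarrow> (real \<Rightarrow> real^'k \<Rightarrow> real) \<Rightarrow> bool" where
  "differentiable_under_integral T f \<longleftrightarrow>
     (\<forall>t\<in>{-T<..<T}. integrable lborel (f t)) \<and>
     (\<exists>G. integrable lborel G \<and> (\<forall>t\<in>{-T<..<T}. \<forall>x. \<bar>deriv (\<lambda>s. f s x) t\<bar> \<le> G x))"

text \<open>The functions whose integrals are differentiated in time are the entropy density and
  \<open>\<rho>\<^sub>t L\<Phi>\<^sub>t\<close>; the integrations by parts pair the flux
  \<open>\<rho>\<^sub>t a a\<^sup>T \<nabla>\<Phi>\<^sub>t\<close> with the functions
  \<open>1\<close>, \<open>ln (\<rho>\<^sub>t / \<pi>)\<close> and \<open>L\<Phi>\<^sub>t\<close>.\<close>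

definition integrals_make_sense ::
    "(real^'k \<Rightarrow> real^'n^'k) \<Rightarrow> (real^'k \<Rightarrow> real) \<Rightarrow>
     real \<Rightarrow> (real \<Rightarrow> real^'k \<Rightarrow> real) \<Rightarrow> (real \<Rightarrow> real^'k \<Rightarrow> real) \<Rightarrow> bool" where
  "integrals_make_sense a \<pi> T r p \<longleftrightarrow>
     differentiable_under_integral T (\<lambda>t x. r t x * ln (r t x / \<pi> x)) \<and>
     differentiable_under_integral T (\<lambda>t x. r t x * generator_L a \<pi> (p t) x) \<and>
     (\<forall>t\<in>{-T<..<T}.
        integrable_field (\<lambda>x. r t x *\<^sub>R horizontal_gradient a (p t) x) \<and>
        integrable_field
          (\<lambda>x. (ln (r t x / \<pi> x) * r t x) *\<^sub>R horizontal_gradient a (p t) x) \<and>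
        integrable_field
          (\<lambda>x. (generator_L a \<pi> (p t) x * r t x) *\<^sub>R horizontal_gradient a (p t) x))"

end

theory Submission
  imports Defs "HOL-Real_Asymp.Real_Asymp"
begin

text \<open>Write \<open>h = a a\<^sup>T \<nabla>\<Phi>\<^sub>t\<close>.  Along a geodesic the entropy density and
  \<open>\<rho>\<^sub>t L\<Phi>\<^sub>t\<close> satisfy the pointwise identities
  \<open>\<partial>\<^sub>t (\<rho> ln (\<rho> / \<pi>)) = - div (ln (\<rho> / \<pi>) \<rho> h) - \<rho> L\<Phi>\<close> and
  \<open>\<partial>\<^sub>t (\<rho> L\<Phi>) = - div (L\<Phi> \<rho> h) - \<rho> \<Gamma>\<^sub>2(\<Phi>, \<Phi>)\<close>; the second one
  uses that \<open>\<partial>\<^sub>t\<close> commutes with \<open>L\<close> and that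
  \<open>\<partial>\<^sub>t \<Phi> = - \<Gamma>\<^sub>1(\<Phi>, \<Phi>) / 2\<close>.  Integrating over space kills the divergences, so the
  first derivative of the entropy is \<open>- \<integral> \<rho> L\<Phi>\<close> and the second one is
  \<open>\<integral> \<rho> \<Gamma>\<^sub>2(\<Phi>, \<Phi>)\<close>.\<close>

subsection \<open>Calculus of smooth functions\<close>

abbreviation Cdiff where "Cdiff \<equiv> times_continuously_differentiable_on"

section \<open>Closure properties of finite differentiability classes\<close>

text \<open>On an open set the derivative at a point depends only on nearby values, so agreement on
  \<open>S\<close> passes to every directional derivative and the induction continues.\<close>

lemma Cdiff_cong:
  assumes "open S" "Cdiff k S f" "\<And>x. x \<in> S \<Longrightarrow> f x = g x"
  shows "Cdiff k S g"
  using assms(2,3)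
proof (induction k arbitrary: f g)
  case 0
  then show ?case by (simp cong: continuous_on_cong)
next
  case (Suc k)
  have D: "(g has_derivative frechet_derivative f (at x)) (at x)" if "x \<in> S" for x
    using that Suc.prems \<open>open S\<close>
    by (intro has_derivative_transform_within_open[of f _ x UNIV S g])
       (auto simp: frechet_derivative_works)
  then have "frechet_derivative f (at x) = frechet_derivative g (at x)" if "x \<in> S" for x
    using that frechet_derivative_at by blast
  moreover have "g differentiable (at x)" if "x \<in> S" for x
    using D[OF that] by (auto simp: differentiable_def)
  moreover have "Cdiff k S (\<lambda>x. frechet_derivative f (at x) v)" for v
    using Suc.prems by simp
  ultimately show ?case
    using Suc.IH by (metis (no_types, lifting) times_continuously_differentiable_on.simps(2))
qed

text \<open>By uniqueness of derivatives an explicit \<open>f'\<close> may replace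
  \<open>frechet_derivative\<close> in the recursion; the closure rules below then reduce to the
  classical differentiation rules.\<close>

lemma Cdiff_SucI:
  assumes "open S" "\<And>x. x \<in> S \<Longrightarrow> (f has_derivative f' x) (at x)"
    and "\<And>v. Cdiff k S (\<lambda>x. f' x v)"
  shows "Cdiff (Suc k) S f"
proof -
  have "Cdiff k S (\<lambda>x. frechet_derivative f (at x) v)" for v
    using assms(3)[of v]
    by (rule Cdiff_cong[OF assms(1)]) (use assms(2) frechet_derivative_at in metis)
  then show ?thesis
    using assms(2) by (auto simp: differentiable_def)
qed

lemma Cdiff_has_derivative:
  assumes "Cdiff (Suc k) S f" "x \<in> S"
  shows "(f has_derivative frechet_derivative f (at x)) (at x)"
  using assms by (auto simp: frechet_derivative_works)

text \<open>The product, reciprocal and logarithm rules leave undifferentiated factors, for which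
  the inductions ask for order \<open>k\<close> where order \<open>Suc k\<close> is at hand.\<close>

lemma Cdiff_lower: "Cdiff (Suc k) S f \<Longrightarrow> Cdiff k S f"
proof (induction k arbitrary: f)
  case 0
  then show ?case
    by (auto intro!: continuous_at_imp_continuous_on differentiable_imp_continuous_within)
next
  case (Suc k)
  from Suc.prems have 1: "\<forall>x\<in>S. f differentiable (at x)"
    and 2: "\<And>v. Cdiff (Suc k) S (\<lambda>x. frechet_derivative f (at x) v)"
    by auto
  show ?case
    using 1 Suc.IH[OF 2] by simp
qed

lemma Cdiff_const: "Cdiff k S (\<lambda>x. c)"
  by (induction k arbitrary: c) auto

lemma Cdiff_bounded_linear:
  assumes "bounded_linear l" "open S" "Cdiff k S f"
  shows "Cdiff k S (\<lambda>x. l (f x))"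
  using assms(3)
proof (induction k arbitrary: f)
  case 0
  then show ?case
    using assms(1) by (auto intro: bounded_linear.continuous_on)
next
  case (Suc k)
  show ?case
  proof (rule Cdiff_SucI[OF \<open>open S\<close>])
    show "((\<lambda>x. l (f x)) has_derivative (\<lambda>v. l (frechet_derivative f (at x) v))) (at x)"
      if "x \<in> S" for x
      by (rule bounded_linear.has_derivative[OF assms(1) Cdiff_has_derivative[OF Suc.prems that]])
    show "Cdiff k S (\<lambda>x. l (frechet_derivative f (at x) v))" for v
      using Suc by simp
  qed
qed

text \<open>With an affine inner map the derivative in direction \<open>v\<close> is the outer
  derivative in the fixed direction \<open>l v\<close>, again a composite of the same shape. This
  covers time slices and the projection to space.\<close>

lemma Cdiff_compose_affine:
  assumes "bounded_linear l" "open U" "\<And>x. x \<in> U \<Longrightarrow> c + l x \<in> S" "Cdiff k S f"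
  shows "Cdiff k U (\<lambda>x. f (c + l x))"
  using assms(4)
proof (induction k arbitrary: f)
  case 0
  have "continuous_on U (\<lambda>x. c + l x)"
    by (intro continuous_intros bounded_linear.continuous_on[OF assms(1)])
  with 0 show ?case
    using assms(3) by (auto intro!: continuous_on_compose2[of S f U])
next
  case (Suc k)
  show ?case
  proof (rule Cdiff_SucI[OF \<open>open U\<close>])
    fix x assume x: "x \<in> U"
    have "((\<lambda>x. c + l x) has_derivative l) (at x)"
      using has_derivative_add[OF has_derivative_const[of c]
          bounded_linear_imp_has_derivative[OF assms(1), of "at x"]] by simp
    from has_derivative_compose[OF this Cdiff_has_derivative[OF Suc.prems assms(3)[OF x]]]
    show "((\<lambda>x. f (c + l x)) has_derivative
        (\<lambda>v. frechet_derivative f (at (c + l x)) (l v))) (at x)" .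
  next
    show "Cdiff k U (\<lambda>x. frechet_derivative f (at (c + l x)) (l v))" for v
      using Suc.IH[of "\<lambda>y. frechet_derivative f (at y) (l v)"] Suc.prems by simp
  qed
qed

lemma Cdiff_add:
  assumes "open S" "Cdiff k S f" "Cdiff k S g"
  shows "Cdiff k S (\<lambda>x. f x + g x)"
  using assms(2,3)
proof (induction k arbitrary: f g)
  case 0
  then show ?case by (auto intro: continuous_intros)
next
  case (Suc k)
  show ?case
  proof (rule Cdiff_SucI[OF \<open>open S\<close>])
    show "((\<lambda>x. f x + g x) has_derivative
        (\<lambda>v. frechet_derivative f (at x) v + frechet_derivative g (at x) v)) (at x)"
      if "x \<in> S" for x
      by (rule has_derivative_add[OF Cdiff_has_derivative[OF Suc.prems(1) that]
          Cdiff_has_derivative[OF Suc.prems(2) that]])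
    show "Cdiff k S (\<lambda>x. frechet_derivative f (at x) v + frechet_derivative g (at x) v)" for v
      using Suc by simp
  qed
qed

lemma Cdiff_mult:
  fixes f g :: "'a::real_normed_vector \<Rightarrow> real"
  assumes "open S" "Cdiff k S f" "Cdiff k S g"
  shows "Cdiff k S (\<lambda>x. f x * g x)"
  using assms(2,3)
proof (induction k arbitrary: f g)
  case 0
  then show ?case by (auto intro: continuous_intros)
next
  case (Suc k)
  show ?case
  proof (rule Cdiff_SucI[OF \<open>open S\<close>])
    show "((\<lambda>x. f x * g x) has_derivative
        (\<lambda>v. f x * frechet_derivative g (at x) v + frechet_derivative f (at x) v * g x)) (at x)"
      if "x \<in> S" for x
      by (rule has_derivative_mult[OF Cdiff_has_derivative[OF Suc.prems(1) that]
          Cdiff_has_derivative[OF Suc.prems(2) that]])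
    show "Cdiff k S (\<lambda>x. f x * frechet_derivative g (at x) v + frechet_derivative f (at x) v * g x)"
      for v
      using Suc.prems Cdiff_lower[OF Suc.prems(1)] Cdiff_lower[OF Suc.prems(2)]
      by (intro Cdiff_add \<open>open S\<close> Suc.IH) auto
  qed
qed

text \<open>The derivative \<open>- f' / f^2\<close> contains \<open>inverse (f x)\<close> again,
  but only to order \<open>k\<close>, where the induction hypothesis supplies it.\<close>

lemma Cdiff_inverse:
  fixes f :: "'a::real_normed_vector \<Rightarrow> real"
  assumes "open S" "\<And>x. x \<in> S \<Longrightarrow> f x \<noteq> 0" "Cdiff k S f"
  shows "Cdiff k S (\<lambda>x. inverse (f x))"
  using assms(3)
proof (induction k)
  case 0
  then show ?case using assms(2) by (auto intro!: continuous_on_inverse)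
next
  case (Suc k)
  show ?case
  proof (rule Cdiff_SucI[OF \<open>open S\<close>])
    show "((\<lambda>x. inverse (f x)) has_derivative
        (\<lambda>v. - 1 * (inverse (f x) * frechet_derivative f (at x) v * inverse (f x)))) (at x)"
      if "x \<in> S" for x
      using Deriv.has_derivative_inverse[OF assms(2)[OF that] Cdiff_has_derivative[OF Suc.prems that]] by simp
    show "Cdiff k S (\<lambda>x. - 1 * (inverse (f x) * frechet_derivative f (at x) v * inverse (f x)))" for v
      using Suc.prems by (intro Cdiff_mult Cdiff_const \<open>open S\<close> Suc.IH Cdiff_lower[OF Suc.prems]) auto
  qed
qed

text \<open>A case distinction replaces induction: one differentiation removes the logarithm and
  leaves a product with a reciprocal.\<close>

lemma Cdiff_ln:
  fixes f :: "'a::real_normed_vector \<Rightarrow> real"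
  assumes "open S" "\<And>x. x \<in> S \<Longrightarrow> 0 < f x" "Cdiff k S f"
  shows "Cdiff k S (\<lambda>x. ln (f x))"
proof (cases k)
  case 0
  then show ?thesis using assms(2,3)
    by (auto intro!: continuous_on_ln simp: less_imp_neq[symmetric])
next
  case (Suc m)
  show ?thesis unfolding Suc
  proof (rule Cdiff_SucI[OF \<open>open S\<close>])
    show "((\<lambda>x. ln (f x)) has_derivative
        (\<lambda>v. frechet_derivative f (at x) v * inverse (f x))) (at x)"
      if "x \<in> S" for x
      by (rule has_derivative_ln[where g=f, OF assms(2)[OF that]
          Cdiff_has_derivative[OF assms(3)[unfolded Suc] that]])
    show "Cdiff m S (\<lambda>x. frechet_derivative f (at x) v * inverse (f x))" for v
      using assms(2) assms(3)[unfolded Suc] Cdiff_lower[OF assms(3)[unfolded Suc]]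
      by (intro Cdiff_mult Cdiff_inverse \<open>open S\<close>) (auto simp: less_imp_neq[symmetric])
  qed
qed

section \<open>The same closure properties for smooth functions\<close>

lemma smooth_on_cong:
  assumes "open S" "smooth_on S f" "\<And>x. x \<in> S \<Longrightarrow> f x = g x"
  shows "smooth_on S g"
  using assms Cdiff_cong unfolding smooth_on_def by blast

lemma smooth_on_const: "smooth_on S (\<lambda>x. c)"
  by (simp add: smooth_on_def Cdiff_const)

lemma smooth_on_bounded_linear:
  "bounded_linear l \<Longrightarrow> open S \<Longrightarrow> smooth_on S f \<Longrightarrow> smooth_on S (\<lambda>x. l (f x))"
  by (simp add: smooth_on_def Cdiff_bounded_linear)

lemma smooth_on_compose_affine:
  assumes "bounded_linear l" "open U" "\<And>x. x \<in> U \<Longrightarrow> c + l x \<in> S" "smooth_on S f"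
  shows "smooth_on U (\<lambda>x. f (c + l x))"
  using assms Cdiff_compose_affine[of l U c S _ f] by (simp add: smooth_on_def)

lemma smooth_on_add:
  "open S \<Longrightarrow> smooth_on S f \<Longrightarrow> smooth_on S g \<Longrightarrow> smooth_on S (\<lambda>x. f x + g x)"
  by (simp add: smooth_on_def Cdiff_add)

lemma smooth_on_sum:
  "open S \<Longrightarrow> (\<And>i. i \<in> A \<Longrightarrow> smooth_on S (f i)) \<Longrightarrow> smooth_on S (\<lambda>x. \<Sum>i\<in>A. f i x)"
  by (induction A rule: infinite_finite_induct) (auto intro: smooth_on_const smooth_on_add)

lemma smooth_on_mult:
  fixes f g :: "'a::real_normed_vector \<Rightarrow> real"
  shows "open S \<Longrightarrow> smooth_on S f \<Longrightarrow> smooth_on S g \<Longrightarrow> smooth_on S (\<lambda>x. f x * g x)"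
  by (simp add: smooth_on_def Cdiff_mult)

lemma smooth_on_divide:
  fixes f g :: "'a::real_normed_vector \<Rightarrow> real"
  shows "open S \<Longrightarrow> smooth_on S f \<Longrightarrow> smooth_on S g \<Longrightarrow> (\<And>x. x \<in> S \<Longrightarrow> g x \<noteq> 0) \<Longrightarrow>
    smooth_on S (\<lambda>x. f x / g x)"
  by (simp add: smooth_on_def divide_inverse Cdiff_mult Cdiff_inverse)

lemma smooth_on_ln:
  fixes f :: "'a::real_normed_vector \<Rightarrow> real"
  shows "open S \<Longrightarrow> smooth_on S f \<Longrightarrow> (\<And>x. x \<in> S \<Longrightarrow> 0 < f x) \<Longrightarrow> smooth_on S (\<lambda>x. ln (f x))"
  by (simp add: smooth_on_def Cdiff_ln)

lemma smooth_on_frechet_derivative: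
  "smooth_on S f \<Longrightarrow> smooth_on S (\<lambda>x. frechet_derivative f (at x) v)"
  unfolding smooth_on_def by (metis times_continuously_differentiable_on.simps(2))

lemma smooth_on_has_derivative:
  "smooth_on S f \<Longrightarrow> x \<in> S \<Longrightarrow> (f has_derivative frechet_derivative f (at x)) (at x)"
  unfolding smooth_on_def using Cdiff_has_derivative by blast

lemma smooth_on_continuous_on: "smooth_on S f \<Longrightarrow> continuous_on S f"
  unfolding smooth_on_def by (metis times_continuously_differentiable_on.simps(1))

section \<open>Derivatives along lines and symmetry of mixed second derivatives\<close>

lemma frechet_derivative_along_line:
  assumes "smooth_on S f" "x + s *\<^sub>R v \<in> S"
  shows "((\<lambda>t. f (x + t *\<^sub>R v)) has_real_derivative frechet_derivative f (at (x + s *\<^sub>R v)) v) (at s)"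
proof -
  let ?D = "frechet_derivative f (at (x + s *\<^sub>R v))"
  note D = smooth_on_has_derivative[OF assms]
  have "((\<lambda>t. x + t *\<^sub>R v) has_derivative (\<lambda>h. h *\<^sub>R v)) (at s)"
    by (auto intro!: derivative_eq_intros)
  from has_derivative_compose[OF this D]
  show ?thesis
    by (simp add: has_field_derivative_def has_derivative_bounded_linear[OF D]
        linear_simps mult_commute_abs)
qed

text \<open>Both sides are limits of the same second difference quotient.\<close>

lemma frechet_derivative_commute:
  fixes f :: "'a::real_normed_vector \<Rightarrow> real"
  assumes "open S" "smooth_on S f" "x \<in> S"
  shows "frechet_derivative (\<lambda>y. frechet_derivative f (at y) v) (at x) w =
    frechet_derivative (\<lambda>y. frechet_derivative f (at y) w) (at x) v"
proof -
  obtain e where e: "e > 0" "ball x e \<subseteq> S"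
    using assms openE by blast
  \<comment> \<open>Displacements with both coefficients below \<open>d\<close> stay inside the ball
    of radius \<open>e\<close>; the summand 1 keeps the denominator positive when \<open>v\<close>
    and \<open>w\<close> both vanish.\<close>
  define d where "d = e / (norm v + norm w + 1)"
  have pos: "norm v + norm w + 1 > 0" by (simp add: add_nonneg_pos)
  have d: "d > 0" using e pos by (simp add: d_def)
  \<comment> \<open>Only the sum of the two norms is prescribed, so that \<open>(v, w)\<close> and
    \<open>(w, v)\<close> are both admissible for \<open>(a, b)\<close>.\<close>
  have inS: "x + (s *\<^sub>R a + t *\<^sub>R b) \<in> S"
    if "0 \<le> s" "s < d" "0 \<le> t" "t < d" "norm a + norm b = norm v + norm w" for s t a b
  proof -
    have "norm (s *\<^sub>R a + t *\<^sub>R b) \<le> s * norm a + t * norm b"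
      using norm_triangle_ineq[of "s *\<^sub>R a" "t *\<^sub>R b"] that by simp
    also have "\<dots> \<le> d * norm a + d * norm b"
      using that by (intro add_mono mult_right_mono) auto
    also have "\<dots> = d * (norm v + norm w)"
      using that(5) by (simp add: distrib_left[symmetric])
    also have "\<dots> < e" using e pos by (simp add: d_def field_simps)
    finally have "x + (s *\<^sub>R a + t *\<^sub>R b) \<in> ball x e"
      by (metis add_diff_cancel_left' dist_commute dist_norm mem_ball)
    then show ?thesis using e by blast
  qed
  \<comment> \<open>Two applications of the mean value theorem: along \<open>a\<close> to the
    increment of \<open>f\<close> in direction \<open>b\<close>, then along \<open>b\<close> to the
    resulting derivative.\<close>
  have diff: "\<exists>\<sigma> \<tau>. 0 < \<sigma> \<and> \<sigma> < s \<and> 0 < \<tau> \<and> \<tau> < s \<and>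
      f (x + (s *\<^sub>R a + s *\<^sub>R b)) - f (x + s *\<^sub>R a) - f (x + s *\<^sub>R b) + f x =
      s * s * frechet_derivative (\<lambda>y. frechet_derivative f (at y) a)
        (at (x + (\<sigma> *\<^sub>R a + \<tau> *\<^sub>R b))) b"
    if s: "0 < s" "s < d" and ab: "norm a + norm b = norm v + norm w" for s a b
  proof -
    have 1: "((\<lambda>t. f (x + (t *\<^sub>R a + s *\<^sub>R b)) - f (x + t *\<^sub>R a)) has_real_derivative
        frechet_derivative f (at (x + (t *\<^sub>R a + s *\<^sub>R b))) a
        - frechet_derivative f (at (x + t *\<^sub>R a)) a) (at t)"
      if t: "0 \<le> t" "t \<le> s" for t
    proof (rule DERIV_diff)
      have eq: "x + (t *\<^sub>R a + s *\<^sub>R b) = (x + s *\<^sub>R b) + t *\<^sub>R a" for t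
        by (simp add: add_ac)
      show "((\<lambda>t. f (x + (t *\<^sub>R a + s *\<^sub>R b))) has_real_derivative
          frechet_derivative f (at (x + (t *\<^sub>R a + s *\<^sub>R b))) a) (at t)"
        unfolding eq
        by (rule frechet_derivative_along_line[OF assms(2)])
           (use inS[of t s a b] t s ab in \<open>simp add: eq\<close>)
      show "((\<lambda>t. f (x + t *\<^sub>R a)) has_real_derivative
          frechet_derivative f (at (x + t *\<^sub>R a)) a) (at t)"
        by (rule frechet_derivative_along_line[OF assms(2)])
           (use inS[of t 0 a b] t s ab d in auto)
    qed
    from MVT2[OF s(1) 1] obtain \<sigma> where \<sigma>: "0 < \<sigma>" "\<sigma> < s"
      and eq1: "f (x + (s *\<^sub>R a + s *\<^sub>R b)) - f (x + s *\<^sub>R a) - (f (x + s *\<^sub>R b) - f x) =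
        s * (frechet_derivative f (at (x + (\<sigma> *\<^sub>R a + s *\<^sub>R b))) a
        - frechet_derivative f (at (x + \<sigma> *\<^sub>R a)) a)"
      by auto
    have 2: "((\<lambda>t. frechet_derivative f (at (x + (\<sigma> *\<^sub>R a + t *\<^sub>R b))) a) has_real_derivative
        frechet_derivative (\<lambda>y. frechet_derivative f (at y) a)
          (at (x + (\<sigma> *\<^sub>R a + t *\<^sub>R b))) b) (at t)"
      if t: "0 \<le> t" "t \<le> s" for t
      unfolding add.assoc[symmetric]
      by (rule frechet_derivative_along_line[OF smooth_on_frechet_derivative[OF assms(2)]])
         (use inS[of \<sigma> t a b] t \<sigma> s ab in \<open>simp add: add.assoc\<close>)
    from MVT2[OF s(1) 2] obtain \<tau> where "0 < \<tau>" "\<tau> < s"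
      "frechet_derivative f (at (x + (\<sigma> *\<^sub>R a + s *\<^sub>R b))) a
        - frechet_derivative f (at (x + \<sigma> *\<^sub>R a)) a =
        s * frechet_derivative (\<lambda>y. frechet_derivative f (at y) a)
          (at (x + (\<sigma> *\<^sub>R a + \<tau> *\<^sub>R b))) b"
      by auto
    with \<sigma> eq1 show ?thesis
      by (intro exI[of _ \<sigma>] exI[of _ \<tau>]) simp
  qed
  define g where "g a b y = frechet_derivative (\<lambda>y. frechet_derivative f (at y) a) (at y) b"
    for a b y
  \<comment> \<open>Positive step sizes tending to 0; the shift by 2 keeps them strictly below
    \<open>d\<close> already at \<open>n = 0\<close>.\<close>
  define s where "s n = d / (real n + 2)" for n
  have s: "0 < s n" "s n < d" for n
    using d by (auto simp: s_def field_simps intro: add_pos_nonneg)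
  have s0: "s \<longlonglongrightarrow> 0"
    unfolding s_def by real_asymp
  have lim: "(\<lambda>n. (f (x + (s n *\<^sub>R a + s n *\<^sub>R b)) - f (x + s n *\<^sub>R a)
      - f (x + s n *\<^sub>R b) + f x) / (s n * s n)) \<longlonglongrightarrow> g a b x"
    if ab: "norm a + norm b = norm v + norm w" for a b
  proof -
    from diff[OF s ab] obtain \<sigma> \<tau> where st: "\<And>n. 0 < \<sigma> n" "\<And>n. \<sigma> n < s n" "\<And>n. 0 < \<tau> n"
      "\<And>n. \<tau> n < s n"
      and eq: "\<And>n. f (x + (s n *\<^sub>R a + s n *\<^sub>R b)) - f (x + s n *\<^sub>R a)
      - f (x + s n *\<^sub>R b) + f x = s n * s n * g a b (x + (\<sigma> n *\<^sub>R a + \<tau> n *\<^sub>R b))"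
      unfolding g_def by metis
    have "\<sigma> \<longlonglongrightarrow> 0" "\<tau> \<longlonglongrightarrow> 0"
      using st by (auto intro!: tendsto_sandwich[OF _ _ tendsto_const s0] always_eventually less_imp_le)
    then have "(\<lambda>n. x + (\<sigma> n *\<^sub>R a + \<tau> n *\<^sub>R b)) \<longlonglongrightarrow> x + (0 *\<^sub>R a + 0 *\<^sub>R b)"
      by (intro tendsto_intros)
    moreover have "isCont (g a b) x"
      unfolding g_def using assms
      by (metis continuous_on_eq_continuous_at smooth_on_continuous_on smooth_on_frechet_derivative)
    ultimately have "(\<lambda>n. g a b (x + (\<sigma> n *\<^sub>R a + \<tau> n *\<^sub>R b))) \<longlonglongrightarrow> g a b x"
      using isCont_tendsto_compose by fastforce
    moreover have "s n \<noteq> 0" for n using s(1)[of n] by simp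
    ultimately show ?thesis by (simp add: eq)
  qed
  \<comment> \<open>The second difference is symmetric in its two directions, so both limits belong
    to one sequence.\<close>
  have "g v w x = g w v x"
    using LIMSEQ_unique[OF lim[of v w]] lim[of w v] by (simp add: algebra_simps)
  then show ?thesis by (simp add: g_def)
qed

subsection \<open>Differential operators and time-dependent families\<close>

lemma gradient_eqI:
  "(f has_derivative f') (at x) \<Longrightarrow> gradient f x $ i = f' (axis i 1)"
  using frechet_derivative_at by (fastforce simp: gradient_def)

lemma divergence_gradient: "divergence X x = (\<Sum>i\<in>UNIV. gradient (\<lambda>y. X y $ i) x $ i)"
  by (simp add: divergence_def gradient_def)

lemma smooth_on_gradient: "smooth_on S f \<Longrightarrow> smooth_on S (\<lambda>x. gradient f x $ i)"
  by (simp add: gradient_def smooth_on_frechet_derivative)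

lemma smooth_on_differentiable: "smooth_on UNIV f \<Longrightarrow> f differentiable (at x)"
  using smooth_on_has_derivative differentiable_def by blast

lemma gradient_mult:
  assumes "f differentiable (at x)" "g differentiable (at x)"
  shows "gradient (\<lambda>y. f y * g y) x $ i = f x * gradient g x $ i + gradient f x $ i * g x"
  using gradient_eqI[OF has_derivative_mult] assms
  by (simp add: frechet_derivative_works gradient_def)

lemma divergence_scaleR:
  assumes "f differentiable (at x)" "\<And>i. (\<lambda>y. X y $ i) differentiable (at x)"
  shows "divergence (\<lambda>y. f y *\<^sub>R X y) x = f x * divergence X x + gradient f x \<bullet> X x"
  using assms
  by (simp add: divergence_gradient gradient_mult inner_vec_def sum.distrib sum_distrib_left)

lemma gradient_ln:
  assumes "f differentiable (at x)" "0 < f x"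
  shows "gradient (\<lambda>y. ln (f y)) x $ i = gradient f x $ i / f x"
  using gradient_eqI[OF has_derivative_ln[where g=f, OF assms(2)]] assms(1)
  by (simp add: frechet_derivative_works gradient_def divide_inverse)

text \<open>The logarithm of the quotient splits into a difference. Multiplying by
  \<open>f x\<close> clears the denominator and gives the term
  \<open>\<rho> \<nabla> ln (\<rho> / \<pi>)\<close> met when the flux is integrated by
  parts.\<close>

lemma gradient_ln_divide:
  assumes "f differentiable (at x)" "g differentiable (at x)" "\<And>y. 0 < f y" "\<And>y. 0 < g y"
  shows "f x *\<^sub>R gradient (\<lambda>y. ln (f y / g y)) x =
    gradient f x - f x *\<^sub>R gradient (\<lambda>y. ln (g y)) x"
proof (rule vec_eq_iff[THEN iffD2], rule allI)
  fix i
  have "(\<lambda>y. ln (f y / g y)) = (\<lambda>y. ln (f y) - ln (g y))"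
    using assms(3,4) by (simp add: ln_div less_imp_neq[symmetric])
  moreover have "((\<lambda>y. ln (f y) - ln (g y)) has_derivative
    (\<lambda>v. frechet_derivative f (at x) v * inverse (f x) - frechet_derivative g (at x) v * inverse (g x)))
      (at x)"
    using assms(1,2)
    by (intro has_derivative_diff has_derivative_ln assms(3,4)) (auto simp: frechet_derivative_works)
  ultimately have "gradient (\<lambda>y. ln (f y / g y)) x $ i = gradient f x $ i / f x - gradient g x $ i / g x"
    using gradient_eqI by (fastforce simp: gradient_def divide_inverse)
  then show "(f x *\<^sub>R gradient (\<lambda>y. ln (f y / g y)) x) $ i =
    (gradient f x - f x *\<^sub>R gradient (\<lambda>y. ln (g y)) x) $ i"
    using assms(3)[of x] by (simp add: gradient_ln assms field_simps)
qed

lemma horizontal_gradient_nth: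
  "horizontal_gradient a f x $ i = (\<Sum>j\<in>UNIV. (a x ** transpose (a x)) $ i $ j * gradient f x $ j)"
  by (simp add: horizontal_gradient_def matrix_vector_mult_def)

text \<open>Adjointness moves one factor \<open>a\<close> across the inner product, which yields the
  form produced by the product rule for divergences.\<close>

lemma Gamma1_horizontal_gradient: "Gamma1 a f g x = gradient f x \<bullet> horizontal_gradient a g x"
  by (simp add: Gamma1_def horizontal_gradient_def dot_lmul_matrix
      matrix_vector_mul_assoc[symmetric] transpose_matrix_vector)

lemma smooth_on_diffusion_matrix:
  fixes a :: "real^'k \<Rightarrow> real^'n^'k"
  assumes "smooth_on UNIV a"
  shows "smooth_on UNIV (\<lambda>x. (a x ** transpose (a x)) $ i $ j)"
proof -
  have "smooth_on UNIV (\<lambda>x. a x $ i $ k)" for i k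
    using assms
    by (intro smooth_on_bounded_linear[of "\<lambda>v. v $ i $ k" UNIV a]
        bounded_linear_compose[OF bounded_linear_vec_nth bounded_linear_vec_nth]) auto
  then show ?thesis
    by (auto simp: matrix_matrix_mult_def transpose_def intro!: smooth_on_sum smooth_on_mult)
qed

lemma smooth_on_horizontal_gradient:
  assumes "smooth_on UNIV a" "smooth_on UNIV f"
  shows "smooth_on UNIV (\<lambda>x. horizontal_gradient a f x $ i)"
  unfolding horizontal_gradient_nth using assms
  by (intro smooth_on_sum smooth_on_mult smooth_on_gradient smooth_on_diffusion_matrix) auto

lemma smooth_on_Gamma1:
  assumes "smooth_on UNIV a" "smooth_on UNIV f" "smooth_on UNIV g"
  shows "smooth_on UNIV (Gamma1 a f g)"
  unfolding Gamma1_horizontal_gradient[abs_def] inner_vec_def inner_real_def using assms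
  by (intro smooth_on_sum smooth_on_mult smooth_on_gradient smooth_on_horizontal_gradient) auto

text \<open>In coordinates \<open>L\<close> uses only partial derivatives, products with fixed
  coefficients and finite sums, so closure under these three suffices for smoothness and for time
  evolution.\<close>

lemma generator_L_sum:
  "generator_L a \<pi> f x = (\<Sum>i\<in>UNIV. gradient (\<lambda>y. horizontal_gradient a f y $ i) x $ i)
    + (\<Sum>i\<in>UNIV. gradient (\<lambda>y. ln (\<pi> y)) x $ i * horizontal_gradient a f x $ i)"
  by (simp add: generator_L_def divergence_gradient inner_vec_def)

lemma smooth_on_generator_L:
  assumes "smooth_on UNIV a" "smooth_on UNIV (\<lambda>x. ln (\<pi> x))" "smooth_on UNIV f"
  shows "smooth_on UNIV (generator_L a \<pi> f)"
  unfolding generator_L_sum[abs_def] using assms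
  by (intro smooth_on_sum smooth_on_mult smooth_on_gradient smooth_on_add
      smooth_on_horizontal_gradient) auto

lemma gradient_cmult:
  "f differentiable (at x) \<Longrightarrow> gradient (\<lambda>y. c * f y) x $ i = c * gradient f x $ i"
  using gradient_eqI[OF has_derivative_mult_right]
  by (simp add: frechet_derivative_works gradient_def)

lemma generator_L_cmult:
  assumes "smooth_on UNIV a" "smooth_on UNIV f"
  shows "generator_L a \<pi> (\<lambda>y. c * f y) x = c * generator_L a \<pi> f x"
proof -
  have *: "horizontal_gradient a (\<lambda>y. c * f y) y $ i = c * horizontal_gradient a f y $ i" for y i
    using assms(2)[THEN smooth_on_differentiable]
    by (simp add: horizontal_gradient_nth gradient_cmult sum_distrib_left mult.left_commute)
  show ?thesis
    using smooth_on_horizontal_gradient[OF assms, THEN smooth_on_differentiable]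
    by (simp add: generator_L_sum * gradient_cmult sum_distrib_left distrib_left mult.left_commute)
qed

section \<open>Time-dependent families and the exchange of time and space derivatives\<close>

text \<open>Here \<open>u'\<close> is the time derivative of \<open>u\<close>. Joint smoothness in
  time and space is included because it permits exchanging mixed derivatives and makes the notion
  stable under spatial differentiation.\<close>

definition evolves ::
    "real set \<Rightarrow> (real \<Rightarrow> 'a::real_normed_vector \<Rightarrow> real) \<Rightarrow> (real \<Rightarrow> 'a \<Rightarrow> real) \<Rightarrow> bool" where
  "evolves I u u' \<longleftrightarrow>
     smooth_on (I \<times> UNIV) (\<lambda>(t, x). u t x) \<and> smooth_on (I \<times> UNIV) (\<lambda>(t, x). u' t x) \<and>
     (\<forall>t\<in>I. \<forall>x. ((\<lambda>s. u s x) has_real_derivative u' t x) (at t))"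

lemma has_real_derivative_time_slice:
  assumes "smooth_on (I \<times> UNIV) (\<lambda>(t, x). u t x)" "t \<in> I"
  shows "((\<lambda>s. u s x) has_real_derivative
    frechet_derivative (\<lambda>(t, x). u t x) (at (t, x)) (1, 0)) (at t)"
  using frechet_derivative_along_line[OF assms(1), of "(0, x)" t "(1, 0)"] assms(2) by simp

lemma has_derivative_space_slice:
  assumes "smooth_on (I \<times> UNIV) (\<lambda>(t, x). u t x)" "t \<in> I"
  shows "(u t has_derivative (\<lambda>v. frechet_derivative (\<lambda>(t, x). u t x) (at (t, x)) (0, v))) (at x)"
proof -
  have "((\<lambda>x. (t, x)) has_derivative (\<lambda>v. (0, v))) (at x)"
    by (auto intro!: derivative_eq_intros)
  from has_derivative_compose[OF this smooth_on_has_derivative[OF assms(1)]] assms(2)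
  show ?thesis by simp
qed

text \<open>Smoothness of \<open>u'\<close> is automatic: on \<open>I \<times> UNIV\<close> it is
  the directional derivative of the joint function along \<open>(1, 0)\<close>.\<close>

lemma evolvesI:
  assumes "open I" "smooth_on (I \<times> UNIV) (\<lambda>(t, x). u t x)"
    "\<And>t x. t \<in> I \<Longrightarrow> ((\<lambda>s. u s x) has_real_derivative u' t x) (at t)"
  shows "evolves I u u'"
proof -
  have "smooth_on (I \<times> UNIV) (\<lambda>(t, x). u' t x)"
    by (rule smooth_on_cong[OF _ smooth_on_frechet_derivative[OF assms(2), of "(1, 0)"]])
       (use assms has_real_derivative_time_slice DERIV_unique in
         \<open>fastforce intro: open_Times\<close>)+
  then show ?thesis using assms by (auto simp: evolves_def)
qed

lemma evolves_slice:
  assumes "evolves I u u'" "t \<in> I"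
  shows "smooth_on UNIV (u t)" "smooth_on UNIV (u' t)"
proof -
  have "smooth_on UNIV (v t)" if "smooth_on (I \<times> UNIV) (\<lambda>(t, x). v t x)"
    for v :: "real \<Rightarrow> 'a \<Rightarrow> real"
    using smooth_on_compose_affine[of "\<lambda>x. (0, x)" UNIV "(t, 0)", OF _ _ _ that] \<open>t \<in> I\<close>
    by (simp add: bounded_linear_Pair bounded_linear_zero bounded_linear_ident)
  then show "smooth_on UNIV (u t)" "smooth_on UNIV (u' t)"
    using assms by (auto simp: evolves_def)
qed

lemma evolves_add:
  assumes "open I" "evolves I u u'" "evolves I v v'"
  shows "evolves I (\<lambda>t x. u t x + v t x) (\<lambda>t x. u' t x + v' t x)"
  using assms smooth_on_add[of "I \<times> UNIV" "\<lambda>(t, x). u t x" "\<lambda>(t, x). v t x"]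
  by (intro evolvesI) (auto simp: evolves_def case_prod_unfold open_Times intro!: DERIV_add)

lemma evolves_sum:
  assumes "open I" "\<And>i. i \<in> A \<Longrightarrow> evolves I (u i) (u' i)"
  shows "evolves I (\<lambda>t x. \<Sum>i\<in>A. u i t x) (\<lambda>t x. \<Sum>i\<in>A. u' i t x)"
  using assms(2)
proof (induction A rule: infinite_finite_induct)
  case (insert i A)
  then show ?case by (auto intro!: evolves_add[OF assms(1)])
qed (auto intro!: evolvesI[OF assms(1)] simp: case_prod_unfold smooth_on_const)

lemma evolves_mult:
  assumes "open I" "evolves I u u'" "smooth_on UNIV c"
  shows "evolves I (\<lambda>t x. c x * u t x) (\<lambda>t x. c x * u' t x)"
proof (rule evolvesI[OF assms(1)])
  have "smooth_on (I \<times> UNIV) (\<lambda>z. c (snd z))"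
    using smooth_on_compose_affine[of snd "I \<times> UNIV" 0 UNIV c] assms
    by (simp add: bounded_linear_snd open_Times)
  then show "smooth_on (I \<times> UNIV) (\<lambda>(t, x). c x * u t x)"
    using smooth_on_mult[of "I \<times> UNIV" "\<lambda>z. c (snd z)" "\<lambda>(t, x). u t x"] assms(1,2)
    by (auto simp: evolves_def case_prod_unfold open_Times)
qed (use assms in \<open>auto simp: evolves_def intro!: DERIV_cmult\<close>)

text \<open>Time and space derivatives are directional derivatives of one joint function, along
  \<open>(1, 0)\<close> and \<open>(0, axis i 1)\<close>, so symmetry of second derivatives
  exchanges them.\<close>

lemma evolves_gradient:
  assumes "open I" "evolves I u u'"
  shows "evolves I (\<lambda>t x. gradient (u t) x $ i) (\<lambda>t x. gradient (u' t) x $ i)"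
proof (rule evolvesI[OF assms(1)])
  let ?U = "\<lambda>(t, x). u t x"
  have u: "smooth_on (I \<times> UNIV) ?U" and u': "smooth_on (I \<times> UNIV) (\<lambda>(t, x). u' t x)"
    using assms by (auto simp: evolves_def)
  have op: "open (I \<times> (UNIV :: (real^'a) set))" using assms(1) by (rule open_Times) simp
  have g: "gradient (u t) x $ i = frechet_derivative ?U (at (t, x)) (0, axis i 1)" if "t \<in> I" for t x
    using gradient_eqI[OF has_derivative_space_slice[OF u that]] .
  show sm: "smooth_on (I \<times> UNIV) (\<lambda>(t, x). gradient (u t) x $ i)"
    by (rule smooth_on_cong[OF op smooth_on_frechet_derivative[OF u, of "(0, axis i 1)"]])
       (auto simp: g)
  fix t x assume t: "t \<in> I"
  have eq: "frechet_derivative ?U (at z) (1, 0) = (case z of (t, x) \<Rightarrow> u' t x)" if "z \<in> I \<times> UNIV" for z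
    using that assms(2) has_real_derivative_time_slice[OF u] DERIV_unique
    by (fastforce simp: evolves_def)
  have "((\<lambda>s. frechet_derivative ?U (at (s, x)) (0, axis i 1)) has_real_derivative
      frechet_derivative (\<lambda>z. frechet_derivative ?U (at z) (0, axis i 1)) (at (t, x)) (1, 0)) (at t)"
    using frechet_derivative_along_line[OF smooth_on_frechet_derivative[OF u], of "(0, x)" t "(1, 0)"]
      t by simp
  also have "frechet_derivative (\<lambda>z. frechet_derivative ?U (at z) (0, axis i 1)) (at (t, x)) (1, 0)
      = frechet_derivative (\<lambda>z. frechet_derivative ?U (at z) (1, 0)) (at (t, x)) (0, axis i 1)"
    by (rule frechet_derivative_commute[OF op u]) (use t in auto)
  \<comment> \<open>The two functions agree only on \<open>I \<times> UNIV\<close>; its openness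
    carries the equality to their derivatives.\<close>
  also have "\<dots> = frechet_derivative (\<lambda>(t, x). u' t x) (at (t, x)) (0, axis i 1)"
    using has_derivative_transform_within_open[OF
        smooth_on_has_derivative[OF smooth_on_frechet_derivative[OF u], of "(t, x)" "(1, 0)"]
        op _ eq] t frechet_derivative_at by (metis SigmaI UNIV_I)
  also have "\<dots> = gradient (u' t) x $ i"
    using gradient_eqI[OF has_derivative_space_slice[OF u' t]] by simp
  finally have "((\<lambda>s. frechet_derivative ?U (at (s, x)) (0, axis i 1)) has_real_derivative
      gradient (u' t) x $ i) (at t)" .
  \<comment> \<open>The spatial gradient is identified with the joint derivative only for times in
    \<open>I\<close>, which is enough near \<open>t\<close>.\<close>
  then show "((\<lambda>s. gradient (u s) x $ i) has_real_derivative gradient (u' t) x $ i) (at t)"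
    by (rule DERIV_cong_ev[OF refl _ refl, THEN iffD1, rotated])
       (use g t assms(1) in \<open>auto simp: eventually_nhds\<close>)
qed

text \<open>The coefficients of \<open>L\<close> do not depend on time, so the exchange of
  derivatives propagates through its coordinate form.\<close>

lemma evolves_generator_L:
  assumes "open I" "evolves I u u'" "smooth_on UNIV a" "smooth_on UNIV (\<lambda>x. ln (\<pi> x))"
  shows "evolves I (\<lambda>t. generator_L a \<pi> (u t)) (\<lambda>t. generator_L a \<pi> (u' t))"
proof -
  have "evolves I (\<lambda>t x. horizontal_gradient a (u t) x $ i) (\<lambda>t x. horizontal_gradient a (u' t) x $ i)"
    for i
    unfolding horizontal_gradient_nth using assms
    by (intro evolves_sum evolves_mult evolves_gradient smooth_on_diffusion_matrix) auto
  then show ?thesis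
    unfolding generator_L_sum[abs_def] using assms
    by (intro evolves_add evolves_sum evolves_mult evolves_gradient smooth_on_gradient) auto
qed

subsection \<open>Integrals of derivatives\<close>

text \<open>On the convex set \<open>I\<close> the bound on \<open>f'\<close> makes every difference
  quotient at most \<open>G\<close> in absolute value, so dominated convergence applies along each
  sequence tending to \<open>t\<close>. Measurability of \<open>f' t\<close> comes from its being a
  limit of quotients.\<close>

lemma has_real_derivative_integral:
  fixes f f' :: "real \<Rightarrow> 'a \<Rightarrow> real"
  assumes I: "open I" "convex I" "t \<in> I"
    and int: "\<And>s. s \<in> I \<Longrightarrow> integrable M (f s)"
    and deriv: "\<And>s x. s \<in> I \<Longrightarrow> ((\<lambda>s. f s x) has_real_derivative f' s x) (at s)"
    and G: "integrable M G" "\<And>s x. s \<in> I \<Longrightarrow> \<bar>f' s x\<bar> \<le> G x"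
  shows "integrable M (f' t)"
    and "((\<lambda>s. LINT x|M. f s x) has_real_derivative (LINT x|M. f' t x)) (at t)"
proof -
  have *: "integrable M (f' t) \<and> (\<lambda>n. ((LINT x|M. f (X n) x) - (LINT x|M. f t x)) / (X n - t))
      \<longlonglongrightarrow> (LINT x|M. f' t x)"
    if X: "\<And>n. X n \<in> I - {t}" "X \<longlonglongrightarrow> t" for X
  proof -
    define s where "s n x = (f (X n) x - f t x) / (X n - t)" for n x
    have m: "f t \<in> borel_measurable M" "\<And>n. f (X n) \<in> borel_measurable M"
      using X(1) I(3) int by blast+
    then have sm: "s n \<in> borel_measurable M" for n
      unfolding s_def by measurable
    have lim: "(\<lambda>n. s n x) \<longlonglongrightarrow> f' t x" for x
    proof -
      have "((\<lambda>y. (f y x - f t x) / (y - t)) \<longlongrightarrow> f' t x) (at t within I)"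
        by (rule has_field_derivative_at_within[OF deriv[OF I(3)],
            unfolded has_field_derivative_iff])
      then show ?thesis
        using X unfolding tendsto_at_iff_sequentially s_def comp_def by blast
    qed
    have m': "f' t \<in> borel_measurable M"
      by (rule borel_measurable_LIMSEQ_real[OF lim sm])
    have bound: "norm (s n x) \<le> G x" for n x
    proof -
      have "norm (f (X n) x - f t x) \<le> G x * norm (X n - t)"
        using X(1)[of n] I G deriv
        by (intro field_differentiable_bound[OF I(2), of "\<lambda>s. f s x" "\<lambda>s. f' s x"])
           (auto intro: has_field_derivative_at_within)
      then show ?thesis
        using X(1)[of n] by (simp add: s_def pos_divide_le_eq abs_divide)
    qed
    note dc = integrable_dominated_convergence[OF m' sm G(1) AE_I2[OF lim] AE_I2[OF bound]]
      integral_dominated_convergence[OF m' sm G(1) AE_I2[OF lim] AE_I2[OF bound]]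
    have "integral\<^sup>L M (s n) = ((LINT x|M. f (X n) x) - (LINT x|M. f t x)) / (X n - t)" for n
      unfolding s_def using X(1) I(3) int by simp
    then show ?thesis using dc by simp
  qed
  \<comment> \<open>At least one admissible sequence must exist before integrability of
    \<open>f' t\<close> can be read off.\<close>
  have "t islimpt I"
    using I by (simp add: interior_limit_point interior_open)
  then obtain X where "\<forall>n. X n \<in> I - {t}" "X \<longlonglongrightarrow> t"
    unfolding islimpt_sequential by blast
  then show "integrable M (f' t)" using * by blast
  have "((\<lambda>s. LINT x|M. f s x) has_real_derivative (LINT x|M. f' t x)) (at t within I)"
    unfolding has_field_derivative_iff tendsto_at_iff_sequentially comp_def
    using * by blast
  then show "((\<lambda>s. LINT x|M. f s x) has_real_derivative (LINT x|M. f' t x)) (at t)"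
    by (simp only: at_within_open[OF I(3,1)])
qed

section \<open>Compactly supported functions and translation invariance\<close>

lemma integrable_continuous_compact_support:
  fixes f :: "'a::euclidean_space \<Rightarrow> real"
  assumes "continuous_on UNIV f" "\<And>x. R < norm x \<Longrightarrow> f x = 0"
  shows "\<exists>B\<ge>0. \<forall>x. \<bar>f x\<bar> \<le> B * indicator (cball 0 R) x" "integrable lborel f"
proof -
  have "bounded (f ` cball 0 R)"
    by (intro compact_imp_bounded compact_continuous_image continuous_on_subset[OF assms(1)]) auto
  then obtain B where "0 < B" "\<And>x. x \<in> cball 0 R \<Longrightarrow> \<bar>f x\<bar> \<le> B"
    unfolding bounded_pos by (metis imageI real_norm_def)
  then have B: "\<bar>f x\<bar> \<le> B * indicator (cball 0 R) x" for x
    using assms(2)[of x] by (cases "x \<in> cball 0 R") auto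
  then show "\<exists>B\<ge>0. \<forall>x. \<bar>f x\<bar> \<le> B * indicator (cball 0 R) x"
    using \<open>0 < B\<close> less_imp_le by blast
  show "integrable lborel f"
  proof (rule Bochner_Integration.integrable_bound)
    show "integrable lborel (\<lambda>x. B * indicator (cball (0::'a) R) x :: real)"
      using emeasure_lborel_cball_finite[of "0::'a" R]
      by (intro integrable_mult_right integrable_real_indicator) auto
    show "f \<in> borel_measurable lborel"
      using borel_measurable_continuous_onI[OF assms(1)] by simp
    show "AE x in lborel. norm (f x) \<le> norm (B * indicator (cball 0 R) x)"
      using B by (intro AE_I2) (metis abs_ge_self order_trans real_norm_def)
  qed
qed

lemma integrable_lborel_translation:
  fixes f :: "'a::euclidean_space \<Rightarrow> real"
  assumes "integrable lborel f"
  shows "integrable lborel (\<lambda>x. f (c + x))" "(LINT x|lborel. f (c + x)) = (LINT x|lborel. f x)"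
proof -
  have [measurable]: "f \<in> borel_measurable borel" using assms by auto
  show "integrable lborel (\<lambda>x. f (c + x))"
    using assms by (subst (asm) lborel_distr_plus[of c, symmetric]) (simp add: integrable_distr_eq)
  show "(LINT x|lborel. f (c + x)) = (LINT x|lborel. f x)"
    by (subst (2) lborel_distr_plus[of c, symmetric]) (simp add: integral_distr)
qed

text \<open>The integral of a translate \<open>f (t v + x)\<close> does not depend on \<open>t\<close>, so its
  derivative at \<open>t = 0\<close> vanishes.\<close>

lemma integral_derivative_compact_support:
  fixes f :: "'a::euclidean_space \<Rightarrow> real"
  assumes f: "\<And>x. (f has_derivative f' x) (at x)"
    and cont: "continuous_on UNIV (\<lambda>x. f' x v)"
    and supp: "\<And>x. R < norm x \<Longrightarrow> f x = 0"
  shows "integrable lborel (\<lambda>x. f' x v)" "(LINT x|lborel. f' x v) = 0"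
proof -
  \<comment> \<open>The function vanishes on the open exterior of the ball, hence so does its
    derivative.\<close>
  have supp': "f' x v = 0" if "R < norm x" for x
  proof -
    have "open {x::'a. R < norm x}" by (intro open_Collect_less continuous_intros)
    from has_derivative_transform_within_open[OF f this, of x "\<lambda>_. 0"] that supp
    have "((\<lambda>_. 0) has_derivative f' x) (at x)" by simp
    then show ?thesis
      using has_derivative_unique[OF _ has_derivative_const] by fastforce
  qed
  note cs = integrable_continuous_compact_support[OF cont supp']
  have "continuous_on UNIV f"
    using f by (auto intro!: continuous_at_imp_continuous_on has_derivative_continuous)
  note int = integrable_continuous_compact_support(2)[OF this supp]
  show "integrable lborel (\<lambda>x. f' x v)" by (rule cs(2))
  obtain B where B0: "0 \<le> B" and B: "\<And>x. \<bar>f' x v\<bar> \<le> B * indicator (cball 0 R) x" using cs(1) by blast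
  have "((\<lambda>s. LINT x|lborel. f (s *\<^sub>R v + x)) has_real_derivative
      (LINT x|lborel. f' (0 *\<^sub>R v + x) v)) (at 0)"
  proof (rule has_real_derivative_integral(2)[where I="{-1<..<1}"])
    show "integrable lborel (\<lambda>x. f (s *\<^sub>R v + x))" for s
      by (rule integrable_lborel_translation[OF int])
    show "((\<lambda>s. f (s *\<^sub>R v + x)) has_real_derivative f' (s *\<^sub>R v + x) v) (at s)" for s x
    proof -
      have "((\<lambda>s. s *\<^sub>R v + x) has_derivative (\<lambda>h. h *\<^sub>R v)) (at s)"
        by (auto intro!: derivative_eq_intros)
      from has_derivative_compose[OF this f] show ?thesis
        by (simp add: has_field_derivative_def has_derivative_bounded_linear[OF f] linear_simps
            mult_commute_abs)
    qed
    \<comment> \<open>For \<open>\<bar>s\<bar> < 1\<close> the shift by \<open>s *\<^sub>R v\<close>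
      moves the support by at most \<open>norm v\<close>; the enlarged ball dominates all translates
      at once.\<close>
    show "integrable lborel (\<lambda>x. B * indicator (cball (0::'a) (R + norm v)) x :: real)"
      using emeasure_lborel_cball_finite[of "0::'a" "R + norm v"]
      by (intro integrable_mult_right integrable_real_indicator) auto
    show "\<bar>f' (s *\<^sub>R v + x) v\<bar> \<le> B * indicator (cball 0 (R + norm v)) x"
      if s: "s \<in> {-1<..<1}" for s x
    proof (cases "x \<in> cball 0 (R + norm v)")
      case True
      have "\<bar>f' (s *\<^sub>R v + x) v\<bar> \<le> B * 1"
        by (rule order_trans[OF B]) (intro mult_left_mono B0, simp add: indicator_def)
      then show ?thesis using True by simp
    next
      case False
      have "norm (s *\<^sub>R v) \<le> norm v"
        using s by (simp add: abs_le_iff mult_left_le_one_le)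
      then have "R < norm (s *\<^sub>R v + x)"
        using False norm_triangle_ineq2[of x "- (s *\<^sub>R v)"] by (simp add: add.commute)
      then show ?thesis using supp' False by simp
    qed
  qed auto
  moreover have "((\<lambda>s. LINT x|lborel. f (s *\<^sub>R v + x)) has_real_derivative 0) (at 0)"
    by (simp add: integrable_lborel_translation(2)[OF int])
  ultimately show "(LINT x|lborel. f' x v) = 0"
    using DERIV_unique by fastforce
qed

section \<open>A cut-off function and the vanishing integral of a divergence\<close>

text \<open>Squaring removes the kink of the positive part: both one-sided slopes at 0
  vanish.\<close>

lemma has_real_derivative_max_power2:
  fixes s :: real
  shows "((\<lambda>s. (max 0 s)\<^sup>2) has_real_derivative 2 * max 0 s) (at s)"
proof -
  consider "s > 0" | "s < 0" | "s = 0" by linarith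
  then show ?thesis
  proof cases
    case 1
    have "((\<lambda>s. s\<^sup>2) has_real_derivative 2 * max 0 s) (at s)"
      using 1 by (auto intro!: derivative_eq_intros)
    then show ?thesis
      by (rule has_field_derivative_transform_within_open[of _ _ _ "{0<..}"]) (use 1 in auto)
  next
    case 2
    have "((\<lambda>s. 0) has_real_derivative 2 * max 0 s) (at s)"
      using 2 by (auto intro!: derivative_eq_intros)
    then show ?thesis
      by (rule has_field_derivative_transform_within_open[of _ _ _ "{..<0}"]) (use 2 in auto)
  next
    case 3
    have "((\<lambda>h::real. (max 0 h)\<^sup>2 / h) \<longlongrightarrow> 0) (at 0)"
    proof (rule Lim_null_comparison[where g="\<lambda>h. \<bar>h\<bar>"])
      show "\<forall>\<^sub>F h in at 0. norm ((max 0 h)\<^sup>2 / h) \<le> \<bar>h\<bar>" for h :: real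
        by (intro always_eventually allI) (auto simp: max_def power2_eq_square)
      show "((\<lambda>h::real. \<bar>h\<bar>) \<longlongrightarrow> 0) (at 0)"
        by (auto intro!: tendsto_eq_intros)
    qed
    then show ?thesis using 3 by (simp add: DERIV_def)
  qed
qed

text \<open>A bump of class C^1 given by an explicit formula, which is as much regularity as the
  compact-support lemma requires. It is supported in the ball of radius \<open>R\<close> (for
  \<open>R > 0\<close>) and tends to 1 pointwise as \<open>R\<close> grows.\<close>

definition cutoff :: "real \<Rightarrow> 'a::real_inner \<Rightarrow> real" where
  "cutoff R x = (max 0 (1 - x \<bullet> x / R\<^sup>2))\<^sup>2"

definition cutoff_deriv :: "real \<Rightarrow> 'a::real_inner \<Rightarrow> 'a \<Rightarrow> real" where
  "cutoff_deriv R x v = 2 * max 0 (1 - x \<bullet> x / R\<^sup>2) * (- (2 * (x \<bullet> v)) / R\<^sup>2)"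

lemma has_derivative_cutoff: "(cutoff R has_derivative cutoff_deriv R x) (at x)"
proof -
  have "((\<lambda>x. 1 - x \<bullet> x / R\<^sup>2) has_derivative (\<lambda>v. - (2 * (x \<bullet> v)) / R\<^sup>2)) (at x)"
    by (auto intro!: derivative_eq_intros simp: inner_commute divide_inverse)
  from has_derivative_compose[OF this has_real_derivative_max_power2[THEN has_field_derivative_imp_has_derivative]]
  show ?thesis
    by (simp add: cutoff_def[abs_def] cutoff_deriv_def[abs_def])
qed

lemma continuous_on_cutoff_deriv: "continuous_on S (\<lambda>x. cutoff_deriv R x v)"
  unfolding cutoff_deriv_def divide_inverse
  by (intro continuous_on_mult continuous_on_max continuous_on_diff continuous_on_minus
      continuous_on_inner continuous_on_id continuous_on_const)

lemma cutoff_profile_outside: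
  assumes "0 < R" "R < norm x"
  shows "max 0 (1 - x \<bullet> x / R\<^sup>2) = 0"
proof -
  have "R\<^sup>2 \<le> x \<bullet> x"
    unfolding dot_square_norm using assms by (intro power_mono) auto
  then have "1 \<le> x \<bullet> x / R\<^sup>2" using assms by (simp add: pos_le_divide_eq)
  then show ?thesis by simp
qed

lemma cutoff_outside: "0 < R \<Longrightarrow> R < norm x \<Longrightarrow> cutoff R x = 0"
  by (simp add: cutoff_def cutoff_profile_outside)

lemma cutoff_bound: "0 \<le> cutoff R x" "cutoff R x \<le> 1"
  by (simp_all add: cutoff_def power_le_one)

text \<open>Inside the ball Cauchy-Schwarz gives \<open>\<bar>x \<bullet> v\<bar> \<le> R\<close>
  against the factor \<open>4 / R^2\<close>; outside, the profile is 0.\<close>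

lemma cutoff_deriv_bound:
  assumes "0 < R" "norm v \<le> 1"
  shows "\<bar>cutoff_deriv R x v\<bar> \<le> 4 / R"
proof (cases "norm x \<le> R")
  case True
  have 1: "\<bar>x \<bullet> v\<bar> \<le> R * 1"
    using Cauchy_Schwarz_ineq2[of x v] True assms by (meson mult_mono norm_ge_zero order_trans less_imp_le)
  have 2: "\<bar>max 0 (1 - x \<bullet> x / R\<^sup>2)\<bar> \<le> 1" by (simp add: max_def)
  have "\<bar>cutoff_deriv R x v\<bar> = \<bar>max 0 (1 - x \<bullet> x / R\<^sup>2)\<bar> * \<bar>x \<bullet> v\<bar> * (4 / R\<^sup>2)"
    by (simp add: cutoff_deriv_def abs_mult)
  also have "\<dots> \<le> 1 * (R * 1) * (4 / R\<^sup>2)"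
    using assms by (intro mult_right_mono mult_mono 1 2) auto
  also have "\<dots> = 4 / R" using assms by (simp add: power2_eq_square)
  finally show ?thesis .
next
  case False
  then have "max 0 (1 - x \<bullet> x / R\<^sup>2) = 0"
    using assms by (intro cutoff_profile_outside) auto
  then show ?thesis using assms by (simp add: cutoff_deriv_def)
qed

lemma cutoff_tendsto: "(\<lambda>n. cutoff (real (Suc n)) x) \<longlonglongrightarrow> 1"
proof -
  have "(\<lambda>n. x \<bullet> x / (real (Suc n))\<^sup>2) \<longlonglongrightarrow> 0" by real_asymp
  from tendsto_diff[OF tendsto_const this, of 1]
  have "(\<lambda>n. (max 0 (1 - x \<bullet> x / (real (Suc n))\<^sup>2))\<^sup>2) \<longlonglongrightarrow> (max 0 (1 - 0))\<^sup>2"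
    by (intro tendsto_power tendsto_max tendsto_const)
  then show ?thesis by (simp add: cutoff_def)
qed

text \<open>The cut-off field has compact support, so its divergence integrates to 0. That
  divergence is the cut-off times \<open>divergence X\<close> plus an error of order
  \<open>1 / R\<close> times \<open>X\<close>; integrability of both pieces lets the radius tend to
  infinity.\<close>

lemma integral_divergence_eq_0:
  fixes X :: "real^'k \<Rightarrow> real^'k"
  assumes X: "\<And>i. smooth_on UNIV (\<lambda>x. X x $ i)" and int: "integrable_field X"
  shows "(LINT x|lborel. divergence X x) = 0"
proof -
  \<comment> \<open>Radii \<open>Suc n\<close> keep the cut-off nondegenerate at
    \<open>n = 0\<close>.\<close>
  let ?\<chi> = "\<lambda>n. cutoff (real (Suc n)) :: real^'k \<Rightarrow> real"
  let ?D = "\<lambda>n. cutoff_deriv (real (Suc n)) :: real^'k \<Rightarrow> real^'k \<Rightarrow> real"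
  \<comment> \<open>This is the \<open>i\<close>-th partial derivative of the \<open>i\<close>-th
    component of the cut-off field.\<close>
  define h where "h n i x = ?\<chi> n x * gradient (\<lambda>x. X x $ i) x $ i + ?D n x (axis i 1) * X x $ i"
    for n i x
  have "integrable lborel (h n i) \<and> (LINT x|lborel. h n i x) = 0" for n i
  proof -
    have "((\<lambda>x. ?\<chi> n x * X x $ i) has_derivative
        (\<lambda>v. ?\<chi> n x * frechet_derivative (\<lambda>x. X x $ i) (at x) v + ?D n x v * X x $ i)) (at x)" for x
      by (intro has_derivative_mult has_derivative_cutoff smooth_on_has_derivative[OF X]) simp
    note D = integral_derivative_compact_support[OF this, of "axis i 1" "real (Suc n)"]
    have "continuous_on UNIV (?\<chi> n)"
      using has_derivative_cutoff
      by (blast intro!: continuous_at_imp_continuous_on has_derivative_continuous)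
    then have "continuous_on UNIV (\<lambda>x. ?\<chi> n x * frechet_derivative (\<lambda>x. X x $ i) (at x) (axis i 1)
        + ?D n x (axis i 1) * X x $ i)"
      using smooth_on_continuous_on[OF X] smooth_on_continuous_on[OF smooth_on_frechet_derivative[OF X]]
      by (intro continuous_on_add continuous_on_mult continuous_on_cutoff_deriv)
    from D[OF this] show ?thesis
      by (simp add: cutoff_outside h_def[abs_def] gradient_def)
  qed
  then have zero: "(LINT x|lborel. (\<Sum>i\<in>UNIV. h n i x)) = 0"
    and meas: "(\<lambda>x. \<Sum>i\<in>UNIV. h n i x) \<in> borel_measurable lborel" for n
    by (simp, metis Bochner_Integration.integrable_sum borel_measurable_integrable)
  have h: "(\<Sum>i\<in>UNIV. h n i x) = ?\<chi> n x * divergence X x + (\<Sum>i\<in>UNIV. ?D n x (axis i 1) * X x $ i)"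
    for n x
    by (simp add: h_def divergence_gradient sum.distrib sum_distrib_left)
  \<comment> \<open>The dominating function uses that the cut-off is at most 1 and that
    \<open>4 / real (Suc n) \<le> 4\<close> for all \<open>n\<close>.\<close>
  have "(\<lambda>n. LINT x|lborel. (\<Sum>i\<in>UNIV. h n i x)) \<longlonglongrightarrow> (LINT x|lborel. divergence X x)"
  proof (rule integral_dominated_convergence[where w="\<lambda>x. \<bar>divergence X x\<bar> + (\<Sum>i\<in>UNIV. 4 * \<bar>X x $ i\<bar>)"])
    show "divergence X \<in> borel_measurable lborel" using int by (auto simp: integrable_field_def)
    have "integrable lborel (\<lambda>x. X x $ i)" for i
      using int by (auto simp: integrable_field_def intro: integrable_bounded_linear[OF bounded_linear_vec_nth])
    then show "integrable lborel (\<lambda>x. \<bar>divergence X x\<bar> + (\<Sum>i\<in>UNIV. 4 * \<bar>X x $ i\<bar>))"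
      using int by (auto simp: integrable_field_def)
    show "AE x in lborel. (\<lambda>n. \<Sum>i\<in>UNIV. h n i x) \<longlonglongrightarrow> divergence X x"
    proof (rule AE_I2)
      fix x :: "real^'k"
      have "(\<lambda>n. ?D n x (axis i 1)) \<longlonglongrightarrow> 0" for i
      proof (rule Lim_null_comparison[where g="\<lambda>n. 4 / real (Suc n)"])
        show "\<forall>\<^sub>F n in sequentially. norm (?D n x (axis i 1)) \<le> 4 / real (Suc n)"
          using cutoff_deriv_bound[of "real (Suc _)" "axis i 1 :: real^'k" x]
          by (intro always_eventually allI) simp
        show "(\<lambda>n. 4 / real (Suc n)) \<longlonglongrightarrow> 0" by real_asymp
      qed
      then have "(\<lambda>n. ?\<chi> n x * divergence X x + (\<Sum>i\<in>UNIV. ?D n x (axis i 1) * X x $ i))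
          \<longlonglongrightarrow> 1 * divergence X x + (\<Sum>i\<in>UNIV. 0 * X x $ i)"
        by (intro tendsto_intros cutoff_tendsto)
      then show "(\<lambda>n. \<Sum>i\<in>UNIV. h n i x) \<longlonglongrightarrow> divergence X x" by (simp add: h)
    qed
    show "AE x in lborel. norm (\<Sum>i\<in>UNIV. h n i x) \<le> \<bar>divergence X x\<bar> + (\<Sum>i\<in>UNIV. 4 * \<bar>X x $ i\<bar>)"
      for n
    proof (rule AE_I2)
      fix x :: "real^'k"
      have "\<bar>?D n x (axis i 1)\<bar> \<le> 4" for i
      proof -
        have "4 / real (Suc n) \<le> 4" by (simp add: field_simps)
        then show ?thesis
          using cutoff_deriv_bound[of "real (Suc n)" "axis i 1 :: real^'k" x] by simp
      qed
      then have "\<bar>\<Sum>i\<in>UNIV. ?D n x (axis i 1) * X x $ i\<bar> \<le> (\<Sum>i\<in>UNIV. 4 * \<bar>X x $ i\<bar>)"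
        by (intro sum_abs[THEN order_trans] sum_mono) (simp add: abs_mult mult_right_mono)
      moreover have "\<bar>?\<chi> n x * divergence X x\<bar> \<le> \<bar>divergence X x\<bar>"
        using cutoff_bound[of "real (Suc n)" x] by (simp add: abs_mult mult_left_le_one_le)
      ultimately show "norm (\<Sum>i\<in>UNIV. h n i x) \<le> \<bar>divergence X x\<bar> + (\<Sum>i\<in>UNIV. 4 * \<bar>X x $ i\<bar>)"
        unfolding h real_norm_def by linarith
    qed
  qed (rule meas)
  then show ?thesis by (simp add: zero LIMSEQ_const_iff)
qed

subsection \<open>Variation of the entropy along a geodesic\<close>

lemma smooth_on_ln_density: "smooth_positive_density \<pi> \<Longrightarrow> smooth_on UNIV (\<lambda>x. ln (\<pi> x))"
  by (simp add: smooth_positive_density_def smooth_on_ln)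

lemma smooth_on_ln_ratio:
  assumes "smooth_positive_density \<rho>" "smooth_positive_density \<pi>"
  shows "smooth_on UNIV (\<lambda>x. ln (\<rho> x / \<pi> x))"
  using assms
  by (intro smooth_on_ln smooth_on_divide)
     (auto simp: smooth_positive_density_def less_imp_neq[symmetric])

lemma smooth_on_scaleR_horizontal_gradient:
  assumes "smooth_on UNIV a" "smooth_on UNIV \<phi>" "smooth_on UNIV c"
  shows "smooth_on UNIV (\<lambda>x. (c x *\<^sub>R horizontal_gradient a \<phi> x) $ i)"
  using assms by (simp add: smooth_on_mult smooth_on_horizontal_gradient)

text \<open>The product rule is applied with the whole flux as one factor, because its divergence is
  minus the tangent vector, hence minus the time derivative of the density along a geodesic.\<close>

lemma divergence_weighted_flux:
  assumes "smooth_on UNIV a" "smooth_on UNIV \<phi>" "smooth_on UNIV \<rho>" "smooth_on UNIV c"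
  shows "divergence (\<lambda>y. (c y * \<rho> y) *\<^sub>R horizontal_gradient a \<phi> y) x =
    - (c x * tangent_vector a \<rho> \<phi> x) + \<rho> x * (gradient c x \<bullet> horizontal_gradient a \<phi> x)"
proof -
  have "divergence (\<lambda>y. c y *\<^sub>R (\<rho> y *\<^sub>R horizontal_gradient a \<phi> y)) x =
      c x * divergence (\<lambda>y. \<rho> y *\<^sub>R horizontal_gradient a \<phi> y) x
      + gradient c x \<bullet> (\<rho> x *\<^sub>R horizontal_gradient a \<phi> x)"
    using assms(4) smooth_on_scaleR_horizontal_gradient[OF assms(1-3)]
    by (intro divergence_scaleR smooth_on_differentiable)
  then show ?thesis by (simp add: tangent_vector_def)
qed

text \<open>The factor \<open>ln (\<rho> x / \<pi> x) + 1\<close> is the derivative of the entropy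
  integrand in the density. Its summand 1 contributes minus the divergence of the flux, and that
  divergence equals \<open>\<rho> L\<phi>\<close> plus \<open>\<rho>\<close> times the pairing of
  \<open>\<nabla> ln (\<rho> / \<pi>)\<close> with the horizontal gradient.\<close>

lemma first_variation_pointwise:
  assumes "smooth_on UNIV a" "smooth_positive_density \<pi>" "smooth_positive_density \<rho>" "smooth_on UNIV \<phi>"
  shows "tangent_vector a \<rho> \<phi> x * (ln (\<rho> x / \<pi> x) + 1) =
    - divergence (\<lambda>y. (ln (\<rho> y / \<pi> y) * \<rho> y) *\<^sub>R horizontal_gradient a \<phi> y) x
    - \<rho> x * generator_L a \<pi> \<phi> x"
proof -
  let ?h = "horizontal_gradient a \<phi>"
  have \<rho>: "smooth_on UNIV \<rho>" "\<And>x. 0 < \<rho> x" and \<pi>: "smooth_on UNIV \<pi>" "\<And>x. 0 < \<pi> x"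
    using assms by (auto simp: smooth_positive_density_def)
  have "divergence (\<lambda>y. \<rho> y *\<^sub>R ?h y) x = \<rho> x * divergence ?h x + gradient \<rho> x \<bullet> ?h x"
    using \<rho> smooth_on_horizontal_gradient[OF assms(1,4)]
    by (intro divergence_scaleR smooth_on_differentiable)
  moreover have "\<rho> x * (gradient (\<lambda>y. ln (\<rho> y / \<pi> y)) x \<bullet> ?h x) =
      gradient \<rho> x \<bullet> ?h x - \<rho> x * (gradient (\<lambda>y. ln (\<pi> y)) x \<bullet> ?h x)"
    using arg_cong[OF gradient_ln_divide[OF \<rho>(1)[THEN smooth_on_differentiable]
        \<pi>(1)[THEN smooth_on_differentiable] \<rho>(2) \<pi>(2)], of "\<lambda>v. v \<bullet> ?h x" x]
    by (simp add: inner_diff_left)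
  ultimately show ?thesis
    using divergence_weighted_flux[OF assms(1,4) \<rho>(1) smooth_on_ln_ratio[OF assms(3,2)], of x]
    by (simp add: tangent_vector_def generator_L_def algebra_simps)
qed

text \<open>Taking \<open>L\<phi>\<close> as weight in the flux identity produces
  \<open>\<rho> \<Gamma>\<^sub>1(L\<phi>, \<phi>)\<close>, while linearity of \<open>L\<close> pulls
  out the factor \<open>- (1 / 2)\<close>; together these are
  \<open>- \<rho> \<Gamma>\<^sub>2(\<phi>, \<phi>)\<close> up to a divergence.\<close>

lemma second_variation_pointwise:
  assumes "smooth_on UNIV a" "smooth_positive_density \<pi>" "smooth_on UNIV \<rho>" "smooth_on UNIV \<phi>"
  shows "tangent_vector a \<rho> \<phi> x * generator_L a \<pi> \<phi> x
      + \<rho> x * generator_L a \<pi> (\<lambda>y. - (1 / 2 * Gamma1 a \<phi> \<phi> y)) x =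
    - divergence (\<lambda>y. (generator_L a \<pi> \<phi> y * \<rho> y) *\<^sub>R horizontal_gradient a \<phi> y) x
    - Gamma2 a \<pi> \<phi> x * \<rho> x"
proof -
  have "generator_L a \<pi> (\<lambda>y. - (1 / 2 * Gamma1 a \<phi> \<phi> y)) x =
      - (1 / 2) * generator_L a \<pi> (Gamma1 a \<phi> \<phi>) x"
    using generator_L_cmult[OF assms(1) smooth_on_Gamma1[OF assms(1,4,4)], of \<pi> "- (1 / 2)" x]
    by simp
  then show ?thesis
    using divergence_weighted_flux[OF assms(1,4,3)
        smooth_on_generator_L[OF assms(1) smooth_on_ln_density[OF assms(2)] assms(4)], of x]
    by (simp add: Gamma2_def Gamma1_horizontal_gradient algebra_simps)
qed

section \<open>First and second time derivatives of the entropy\<close>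

text \<open>Uniqueness of derivatives identifies \<open>deriv\<close> with the given
  \<open>f'\<close>, so the dominating function carries over.\<close>

lemma differentiable_under_integralD:
  assumes "differentiable_under_integral T f" "t \<in> {-T<..<T}"
    and "\<And>s x. s \<in> {-T<..<T} \<Longrightarrow> ((\<lambda>s. f s x) has_real_derivative f' s x) (at s)"
  shows "integrable lborel (f' t)"
    "((\<lambda>s. LINT x|lborel. f s x) has_real_derivative (LINT x|lborel. f' t x)) (at t)"
proof -
  obtain G where G: "integrable lborel G"
    "\<And>t x. t \<in> {-T<..<T} \<Longrightarrow> \<bar>deriv (\<lambda>s. f s x) t\<bar> \<le> G x"
    and int: "\<And>t. t \<in> {-T<..<T} \<Longrightarrow> integrable lborel (f t)"
    using assms(1) by (auto simp: differentiable_under_integral_def)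
  have "\<bar>f' s x\<bar> \<le> G x" if "s \<in> {-T<..<T}" for s x
    using G(2)[OF that, of x] DERIV_imp_deriv[OF assms(3)[OF that, of x]] by simp
  note has_real_derivative_integral[OF _ _ assms(2) int assms(3) G(1) this]
  then show "integrable lborel (f' t)"
    "((\<lambda>s. LINT x|lborel. f s x) has_real_derivative (LINT x|lborel. f' t x)) (at t)"
    by simp_all
qed

lemma geodesic_entropy_second_derivative:
  fixes a :: "real^'k \<Rightarrow> real^'n^'k"
  assumes a: "smooth_on UNIV a" and \<pi>: "smooth_positive_density \<pi>"
    and geo: "geodesic_from a \<rho> \<Phi> T r p" and sense: "integrals_make_sense a \<pi> T r p"
  shows "integrable lborel (\<lambda>x. Gamma2 a \<pi> \<Phi> x * \<rho> x)"
    "has_second_derivative_at (\<lambda>t. relative_entropy \<pi> (r t)) (LINT x|lborel. Gamma2 a \<pi> \<Phi> x * \<rho> x) 0"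
proof -
  define I where "I = {-T<..<T}"
  define p' where "p' t x = - (1 / 2 * Gamma1 a (p t) (p t) x)" for t x
  have I: "open I" "0 \<in> I" and ini: "r 0 = \<rho>" "p 0 = \<Phi>"
    using geo by (auto simp: I_def geodesic_from_def)
  have dens: "smooth_positive_density (r t)" if "t \<in> I" for t
    using geo that by (simp add: I_def geodesic_from_def)
  have dr: "((\<lambda>s. r s x) has_real_derivative tangent_vector a (r t) (p t) x) (at t)"
    if "t \<in> I" for t x
    using geo that by (simp add: I_def geodesic_from_def)
  have p: "evolves I p p'"
    using geo by (intro evolvesI) (auto simp: I_def geodesic_from_def p'_def)
  note sm_p = evolves_slice(1)[OF p]
  have sm_r: "smooth_on UNIV (r t)" if "t \<in> I" for t
    using dens[OF that] by (simp add: smooth_positive_density_def)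
  have fields: "integrable_field (\<lambda>x. (ln (r t x / \<pi> x) * r t x) *\<^sub>R horizontal_gradient a (p t) x)"
    "integrable_field (\<lambda>x. (generator_L a \<pi> (p t) x * r t x) *\<^sub>R horizontal_gradient a (p t) x)"
    if "t \<in> I" for t
    using sense that by (auto simp: integrals_make_sense_def I_def)
  have diff1: "differentiable_under_integral T (\<lambda>t x. r t x * ln (r t x / \<pi> x))"
    and diff2: "differentiable_under_integral T (\<lambda>t x. r t x * generator_L a \<pi> (p t) x)"
    using sense by (auto simp: integrals_make_sense_def)

  \<comment> \<open>The first derivative is computed on the whole interval, since the second one at
    0 needs it in a neighbourhood.\<close>
  have e: "((\<lambda>t. relative_entropy \<pi> (r t)) has_real_derivative
      - (LINT x|lborel. r t x * generator_L a \<pi> (p t) x)) (at t)" if t: "t \<in> I" for t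
  proof -
    let ?X = "\<lambda>x. (ln (r t x / \<pi> x) * r t x) *\<^sub>R horizontal_gradient a (p t) x"
    have "((\<lambda>s. r s x * ln (r s x / \<pi> x)) has_real_derivative
        tangent_vector a (r s) (p s) x * (ln (r s x / \<pi> x) + 1)) (at s)" if "s \<in> I" for s x
    proof -
      have "0 < r s x" "0 < \<pi> x"
        using dens[OF that] \<pi> by (auto simp: smooth_positive_density_def)
      then show ?thesis
        by (auto intro!: derivative_eq_intros dr[OF that] simp: field_simps)
    qed
    from differentiable_under_integralD(2)[OF diff1 _ this]
    have "((\<lambda>t. relative_entropy \<pi> (r t)) has_real_derivative
        (LINT x|lborel. tangent_vector a (r t) (p t) x * (ln (r t x / \<pi> x) + 1))) (at t)"
      using t by (simp add: I_def relative_entropy_def)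
    also have "(LINT x|lborel. tangent_vector a (r t) (p t) x * (ln (r t x / \<pi> x) + 1)) =
        (LINT x|lborel. - divergence ?X x - r t x * generator_L a \<pi> (p t) x)"
      by (simp add: first_variation_pointwise[OF a \<pi> dens[OF t] sm_p[OF t]])
    also have "\<dots> = - (LINT x|lborel. divergence ?X x) - (LINT x|lborel. r t x * generator_L a \<pi> (p t) x)"
      using fields(1)[OF t] diff2 t
      by (subst Bochner_Integration.integral_diff)
         (auto simp: integrable_field_def differentiable_under_integral_def I_def)
    also have "(LINT x|lborel. divergence ?X x) = 0"
      by (intro integral_divergence_eq_0 fields(1)[OF t] smooth_on_scaleR_horizontal_gradient a
          sm_p[OF t] smooth_on_mult smooth_on_ln_ratio dens[OF t] \<pi> sm_r[OF t] open_UNIV)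
    finally show ?thesis by simp
  qed

  let ?Y = "\<lambda>x. (generator_L a \<pi> \<Phi> x * \<rho> x) *\<^sub>R horizontal_gradient a \<Phi> x"
  have L: "evolves I (\<lambda>t. generator_L a \<pi> (p t)) (\<lambda>t. generator_L a \<pi> (p' t))"
    by (rule evolves_generator_L[OF I(1) p a smooth_on_ln_density[OF \<pi>]])
  have "((\<lambda>s. r s x * generator_L a \<pi> (p s) x) has_real_derivative
      tangent_vector a (r s) (p s) x * generator_L a \<pi> (p s) x
      + r s x * generator_L a \<pi> (p' s) x) (at s)" if "s \<in> I" for s x
  proof -
    have "((\<lambda>s. generator_L a \<pi> (p s) x) has_real_derivative generator_L a \<pi> (p' s) x) (at s)"
      using L that by (simp add: evolves_def)
    from DERIV_mult[OF dr[OF that, of x] this] show ?thesis by (simp add: mult.commute)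
  qed
  note d2 = differentiable_under_integralD[OF diff2 _ this, of 0]
  have eq: "tangent_vector a (r 0) (p 0) x * generator_L a \<pi> (p 0) x
      + r 0 x * generator_L a \<pi> (p' 0) x = - divergence ?Y x - Gamma2 a \<pi> \<Phi> x * \<rho> x" for x
    using second_variation_pointwise[OF a \<pi> sm_r[OF I(2)] sm_p[OF I(2)], of x]
    by (simp add: p'_def[abs_def] ini)
  have Y: "integrable lborel (divergence ?Y)"
    using fields(2)[OF I(2)] by (simp add: integrable_field_def ini)
  have int: "integrable lborel (\<lambda>x. - divergence ?Y x - Gamma2 a \<pi> \<Phi> x * \<rho> x)"
    using d2(1) I by (simp add: eq I_def)
  \<comment> \<open>The time derivative of \<open>\<rho> L\<Phi>\<close> is integrable by domination
    and the divergence by hypothesis; adding them leaves the \<open>Gamma2\<close> term.\<close>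
  from Bochner_Integration.integrable_add[OF int Y]
  have "integrable lborel (\<lambda>x. - (Gamma2 a \<pi> \<Phi> x * \<rho> x))" by simp
  then show G: "integrable lborel (\<lambda>x. Gamma2 a \<pi> \<Phi> x * \<rho> x)"
    using integrable_minus by fastforce
  have "(LINT x|lborel. divergence ?Y x) = 0"
    using fields(2)[OF I(2)] sm_p[OF I(2)] sm_r[OF I(2)] unfolding ini
    by (intro integral_divergence_eq_0 smooth_on_scaleR_horizontal_gradient a
        smooth_on_mult smooth_on_generator_L smooth_on_ln_density \<pi> open_UNIV)
  then have "(LINT x|lborel. - divergence ?Y x - Gamma2 a \<pi> \<Phi> x * \<rho> x) =
      - (LINT x|lborel. Gamma2 a \<pi> \<Phi> x * \<rho> x)"
    using Y G by simp
  then have "((\<lambda>s. - (LINT x|lborel. r s x * generator_L a \<pi> (p s) x)) has_real_derivative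
      (LINT x|lborel. Gamma2 a \<pi> \<Phi> x * \<rho> x)) (at 0)"
    using DERIV_minus[OF d2(2)] I by (simp add: eq I_def)
  moreover have "\<forall>\<^sub>F s in nhds 0. ((\<lambda>t. relative_entropy \<pi> (r t)) has_real_derivative
      - (LINT x|lborel. r s x * generator_L a \<pi> (p s) x)) (at s)"
    using e I by (auto simp: eventually_nhds)
  ultimately show "has_second_derivative_at (\<lambda>t. relative_entropy \<pi> (r t))
      (LINT x|lborel. Gamma2 a \<pi> \<Phi> x * \<rho> x) 0"
    unfolding has_second_derivative_at_def
    by (intro exI[of _ "\<lambda>s. - (LINT x|lborel. r s x * generator_L a \<pi> (p s) x)"] conjI)
qed

theorem proposition4p5:
  fixes a :: "real^('n::finite + 'm::finite) \<Rightarrow> real^'n^('n + 'm)"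
    and \<pi> \<rho> \<Phi> :: "real^('n + 'm) \<Rightarrow> real"
  assumes "smooth_on UNIV a"
    and "strong_hormander a"
    and "smooth_positive_density \<pi>"
    and "smooth_positive_density \<rho>"
    and "smooth_on UNIV \<Phi>"
    and "\<exists>T r p. geodesic_from a \<rho> \<Phi> T r p \<and> integrals_make_sense a \<pi> T r p"
  shows "integrable lborel (\<lambda>x. Gamma2 a \<pi> \<Phi> x * \<rho> x) \<and>
    has_Hess_W a (integrals_make_sense a \<pi>) (relative_entropy \<pi>) \<rho> \<Phi>
      (LINT x|lborel. Gamma2 a \<pi> \<Phi> x * \<rho> x)"
  \<comment> \<open>The value depends only on \<open>a\<close>, \<open>\<pi>\<close>,
    \<open>\<rho>\<close> and \<open>\<Phi>\<close>, so it is common to all geodesics of the class;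
    the geodesic assumed to exist gives the existence half and the integrability.\<close>
  using geodesic_entropy_second_derivative[OF assms(1,3)] assms(6)
  unfolding has_Hess_W_def by blast

end
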